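(* Let $1\le n<d$ be integers and assume that the $n$-ADR set $E \subset \mathbb{R}^d$ has big pieces of Lipschitz graphs (BPLG), with constants $M<\infty$ and $\delta>0$. Then there exist constants $\rho > 0$ and $C < \infty$, depending only on $M$ and $\delta$ (and on $n,d$), such that the following holds: for every $x \in E$ and every (finite) radius $r \in (0,\operatorname{diam}(E)]$, there exist a subspace $V_{x,r} \in G(d,n)$ and a subset $E_{x,r} \subset E \cap B(x,r)$ such that $\mathcal{H}^n(E_{x,r}) \ge r^n/C$, and, for every $V \in B(V_{x,r},\rho)$, $\pi_{V\sharp}\mathcal{H}^n|_{E_{x,r}} \in L^\infty(V)$ with the uniform bound $$\|\pi_{V\sharp}\mathcal{H}^n|_{E_{x,r}}\|_{L^\infty(V)} \le C.$$
   Context: $\mathcal{H}^n$ is $n$-dimensional Hausdorff measure and $B(x,r)$ is the closed ball in $\mathbb{R}^d$. $n$-ADR: a set $E\subset\mathbb{R}^d$ is $n$-Ahlfors-David regular ($n$-ADR) if there are constants $0<C_1\le C_2<\infty$ such that $C_1 r^n \le \mathcal{H}^n(E\cap B(x,r)) \le C_2 r^n$ for all $x\in E$ and all (finite) $r\in(0,\operatorname{diam}(E)]$. Lipschitz graph: an $n$-dimensional Lipschitz graph in $\mathbb{R}^d$ is a set $\Gamma=\{p+A(p): p\in P\}$, where $P\subset\mathbb{R}^d$ is an $n$-dimensional linear subspace and $A:P\to P^\perp$ is Lipschitz; the Lipschitz constant of $\Gamma$ is that of $A$. BPLG: an $n$-ADR set $E\subset\mathbb{R}^d$ has big pieces of Lipschitz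 graphs with constants $M<\infty$ and $\delta>0$ if for every $x\in E$ and $r\in(0,\operatorname{diam}(E)]$ there is an $n$-dimensional Lipschitz graph $\Gamma_{x,r}$ with Lipschitz constant at most $M$ such that $\mathcal{H}^n(E\cap\Gamma_{x,r}\cap B(x,r))\ge\delta r^n$. Grassmannian: for $1\le k<d$, $G(d,k)$ is the set of $k$-dimensional linear subspaces of $\mathbb{R}^d$, with metric $\|V-W\|_{G(d,k)}=\|\pi_V-\pi_W\|$ (operator norm), where $\pi_V$ is orthogonal projection onto $V$. $B(V,r)$, for $V\in G(d,k)$, is the closed metric ball in $G(d,k)$. $\pi_{V\sharp}\mathcal{H}^n|_{E'}$ denotes the push-forward under $\pi_V$ of the restriction of $\mathcal{H}^n$ to $E'$. Writing that it belongs to $L^p(V)$ means it is absolutely continuous with respect to $\mathcal{H}^n$ on $V$ with density in $L^p(V)=L^p(V,\mathcal{H}^n)$, and its $L^p(V)$-norm is the norm of this density. *)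

theory Defs
  imports "HOL-Analysis.Analysis" "HOL-Probability.Essential_Supremum"
begin

text \<open>The library function diameter is unspecified on unbounded sets; here the diameter of an
  unbounded set is infinite.\<close>

definition ediam :: "'a::metric_space set \<Rightarrow> ennreal" where
  "ediam E = (SUP x\<in>E. SUP y\<in>E. ennreal (dist x y))"

text \<open>The case distinction only matters for \<open>n = 0\<close>, where \<open>0 ^ 0 = 1\<close>.\<close>

definition diam_pow :: "nat \<Rightarrow> 'a::metric_space set \<Rightarrow> ennreal" where
  "diam_pow n U = (if U = {} then 0 else ediam U ^ n)"

definition hausdorff_content :: "nat \<Rightarrow> ennreal \<Rightarrow> 'a::metric_space set \<Rightarrow> ennreal" where
  "hausdorff_content n \<delta> A =
     (INF U\<in>{U :: nat \<Rightarrow> 'a set. A \<subseteq> (\<Union>i. U i) \<and> (\<forall>i. ediam (U i) \<le> \<delta>)}. \<Sum>i. diam_pow n (U i))"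

text \<open>The outer measure \<open>\<H>\<^sup>n\<close>, defined on all sets, without a normalising constant depending
  on \<open>n\<close>.\<close>

definition hausdorff_outer :: "nat \<Rightarrow> 'a::metric_space set \<Rightarrow> ennreal" where
  "hausdorff_outer n A = (SUP \<delta>\<in>{0<..}. hausdorff_content n \<delta> A)"

text \<open>\<open>\<H>\<^sup>n\<close> restricted to an arbitrary (not necessarily measurable) set \<open>E\<close>, as a measure on the
  space \<open>E\<close> with its relative Borel sets. As \<open>\<H>\<^sup>n\<close> is a metric outer measure, it is countably
  additive there; see \<open>emeasure_hausdorff_on\<close> below.\<close>

definition hausdorff_on :: "nat \<Rightarrow> 'a::metric_space set \<Rightarrow> 'a measure" where
  "hausdorff_on n E = measure_of E (sets (restrict_space borel E)) (hausdorff_outer n)"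

lemma ediam_mono: "A \<subseteq> B \<Longrightarrow> ediam A \<le> ediam B"
  unfolding ediam_def by (intro SUP_subset_mono order_refl SUP_mono) auto

lemma ediam_empty [simp]: "ediam {} = 0"
  by (simp add: ediam_def bot_ennreal)

lemma dist_le_ediam: "x \<in> A \<Longrightarrow> y \<in> A \<Longrightarrow> ennreal (dist x y) \<le> ediam A"
  unfolding ediam_def by (meson SUP_upper2 SUP_upper order_refl)

lemma diam_pow_empty [simp]: "diam_pow n {} = 0"
  by (simp add: diam_pow_def)

lemma diam_pow_mono: "A \<subseteq> B \<Longrightarrow> diam_pow n A \<le> diam_pow n B"
  unfolding diam_pow_def by (auto intro!: power_mono ediam_mono)

lemma hausdorff_content_le:
  "A \<subseteq> (\<Union>i. U i) \<Longrightarrow> (\<And>i. ediam (U i) \<le> \<delta>) \<Longrightarrow> hausdorff_content n \<delta> A \<le> (\<Sum>i. diam_pow n (U i))"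
  unfolding hausdorff_content_def by (intro INF_lower) auto

lemma hausdorff_content_mono: "A \<subseteq> B \<Longrightarrow> hausdorff_content n \<delta> A \<le> hausdorff_content n \<delta> B"
  unfolding hausdorff_content_def by (intro INF_superset_mono) auto

lemma hausdorff_content_antimono: "\<delta> \<le> \<delta>' \<Longrightarrow> hausdorff_content n \<delta>' A \<le> hausdorff_content n \<delta> A"
  unfolding hausdorff_content_def by (intro INF_superset_mono) (auto intro: order_trans)

lemma hausdorff_content_le_outer: "0 < \<delta> \<Longrightarrow> hausdorff_content n \<delta> A \<le> hausdorff_outer n A"
  unfolding hausdorff_outer_def by (intro SUP_upper) auto

lemma hausdorff_outer_mono: "A \<subseteq> B \<Longrightarrow> hausdorff_outer n A \<le> hausdorff_outer n B"
  unfolding hausdorff_outer_def by (intro SUP_mono) (auto intro: hausdorff_content_mono)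

lemma hausdorff_outer_empty [simp]: "hausdorff_outer n {} = 0"
proof -
  have "hausdorff_content n \<delta> ({}::'a set) \<le> 0" for \<delta>
    using hausdorff_content_le[of "{}" "\<lambda>_. {}" \<delta> n] by (simp add: diam_pow_def)
  then show ?thesis unfolding hausdorff_outer_def by (simp add: SUP_constant bot_ennreal)
qed

lemma hausdorff_content_UN:
  "hausdorff_content n \<delta> (\<Union>i. A i) \<le> (\<Sum>i. hausdorff_content n \<delta> (A i :: 'a::metric_space set))"
proof (rule ennreal_le_epsilon)
  fix e :: real
  assume e: "0 < e" and fin: "(\<Sum>i. hausdorff_content n \<delta> (A i)) < top"
  let ?c = "\<lambda>i. hausdorff_content n \<delta> (A i)"
  have "?c i < ?c i + e * (1/2)^Suc i" for i
    using fin e by (auto simp: less_top dest!: ennreal_suminf_lessD)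
  then have "\<exists>U. A i \<subseteq> (\<Union>j. U j) \<and> (\<forall>j. ediam (U j) \<le> \<delta>) \<and>
      (\<Sum>j. diam_pow n (U j)) < ?c i + e * (1/2)^Suc i" for i
    unfolding hausdorff_content_def INF_less_iff by blast
  then obtain U where U: "\<And>i. A i \<subseteq> (\<Union>j. U i j)" "\<And>i j. ediam (U i j) \<le> \<delta>"
     "\<And>i. (\<Sum>j. diam_pow n (U i j)) < ?c i + e * (1/2)^Suc i"
    by metis
  define W where "W k = (case prod_decode k of (i, j) \<Rightarrow> U i j)" for k
  have "(\<Union>i. A i) \<subseteq> (\<Union>k. W k)"
  proof
    fix x assume "x \<in> (\<Union>i. A i)"
    then obtain i j where "x \<in> U i j" using U(1) by blast
    then have "x \<in> W (prod_encode (i, j))" by (simp add: W_def)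
    then show "x \<in> (\<Union>k. W k)" by blast
  qed
  then have "hausdorff_content n \<delta> (\<Union>i. A i) \<le> (\<Sum>k. diam_pow n (W k))"
    by (rule hausdorff_content_le) (auto simp: W_def U split: prod.split)
  also have "\<dots> = (\<Sum>k. (\<lambda>(i, j). diam_pow n (U i j)) (prod_decode k))"
    by (intro suminf_cong) (simp add: W_def split: prod.split)
  also have "\<dots> = (\<Sum>i. \<Sum>j. diam_pow n (U i j))"
    by (intro suminf_ennreal_2dimen) auto
  also have "\<dots> \<le> (\<Sum>i. ?c i + e * (1/2)^Suc i)"
    by (intro suminf_le less_imp_le U) auto
  also have "\<dots> = (\<Sum>i. ?c i) + (\<Sum>i. ennreal e * ennreal ((1/2) ^ Suc i))"
    using \<open>0 < e\<close> by (subst suminf_add[symmetric])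
      (auto simp del: ennreal_suminf_cmult simp add: ennreal_mult[symmetric])
  also have "\<dots> = (\<Sum>i. ?c i) + e"
    unfolding ennreal_suminf_cmult
    by (subst suminf_ennreal_eq[OF zero_le_power power_half_series]) auto
  finally show "hausdorff_content n \<delta> (\<Union>i. A i) \<le> (\<Sum>i. ?c i) + e" .
qed

lemma hausdorff_outer_UN:
  "hausdorff_outer n (\<Union>i. A i) \<le> (\<Sum>i. hausdorff_outer n (A i :: 'a::metric_space set))"
  unfolding hausdorff_outer_def[of n "\<Union>i. A i"]
proof (rule SUP_least)
  fix \<delta> :: ennreal assume "\<delta> \<in> {0<..}"
  then have "(\<Sum>i. hausdorff_content n \<delta> (A i)) \<le> (\<Sum>i. hausdorff_outer n (A i))"
    by (intro suminf_le hausdorff_content_le_outer) auto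
  then show "hausdorff_content n \<delta> (\<Union>i. A i) \<le> (\<Sum>i. hausdorff_outer n (A i))"
    using hausdorff_content_UN order_trans by blast
qed

lemma outer_measure_space_hausdorff:
  "outer_measure_space (Pow UNIV) (hausdorff_outer n :: 'a::metric_space set \<Rightarrow> ennreal)"
  unfolding outer_measure_space_def positive_def increasing_def countably_subadditive_def
  using hausdorff_outer_UN by (auto intro: hausdorff_outer_mono)

lemma hausdorff_outer_Un:
  "hausdorff_outer n (A \<union> B) \<le> hausdorff_outer n A + hausdorff_outer n (B :: 'a::metric_space set)"
  using hausdorff_outer_UN[of n "binaryset A B"]
  by (simp add: UN_binaryset_eq suminf_binaryset_eq)

lemma hausdorff_outer_separated:
  fixes A B :: "'a::metric_space set"
  assumes e: "e > 0" "\<And>x y. x \<in> A \<Longrightarrow> y \<in> B \<Longrightarrow> e \<le> dist x y"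
  shows "hausdorff_outer n A + hausdorff_outer n B \<le> hausdorff_outer n (A \<union> B)"
proof -
  have *: "hausdorff_content n \<delta> A + hausdorff_content n \<delta> B \<le> hausdorff_outer n (A \<union> B)"
    if \<delta>: "0 < \<delta>" for \<delta>
  proof -
    define d where "d = min \<delta> (ennreal (e/2))"
    have "0 < d" using \<delta> e by (simp add: d_def)
    have "hausdorff_content n \<delta> A + hausdorff_content n \<delta> B \<le> hausdorff_content n d (A \<union> B)"
      unfolding hausdorff_content_def[of n d]
    proof (rule INF_greatest, clarsimp)
      fix U :: "nat \<Rightarrow> 'a set"
      assume U: "A \<subseteq> (\<Union>i. U i)" "B \<subseteq> (\<Union>i. U i)" "\<forall>i. ediam (U i) \<le> d"
      let ?UA = "\<lambda>i. U i \<inter> A" let ?UB = "\<lambda>i. U i \<inter> B"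
      have dle: "ediam (U i \<inter> X) \<le> \<delta>" for i X
        using ediam_mono[of "U i \<inter> X" "U i"] U(3) by (auto simp: d_def intro: order_trans)
      have disj: "U i \<inter> A = {} \<or> U i \<inter> B = {}" for i
      proof (rule ccontr)
        assume "\<not> ?thesis"
        then obtain x y where xy: "x \<in> U i" "x \<in> A" "y \<in> U i" "y \<in> B" by blast
        have "ennreal (dist x y) \<le> ennreal (e/2)"
          using dist_le_ediam[OF xy(1,3)] U(3) by (auto simp: d_def intro: order_trans)
        then have "dist x y \<le> e/2" using e(1) by simp
        then show False using e(2)[OF xy(2,4)] e(1) by linarith
      qed
      have "diam_pow n (?UA i) + diam_pow n (?UB i) \<le> diam_pow n (U i)" for i
        using disj[of i] diam_pow_mono[of "?UA i" "U i" n] diam_pow_mono[of "?UB i" "U i" n]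
        by (elim disjE) simp_all
      then have "(\<Sum>i. diam_pow n (?UA i) + diam_pow n (?UB i)) \<le> (\<Sum>i. diam_pow n (U i))"
        by (intro suminf_le) auto
      moreover have "(\<Sum>i. diam_pow n (?UA i) + diam_pow n (?UB i)) =
          (\<Sum>i. diam_pow n (?UA i)) + (\<Sum>i. diam_pow n (?UB i))"
        by (intro suminf_add[symmetric]) auto
      moreover have "hausdorff_content n \<delta> A \<le> (\<Sum>i. diam_pow n (?UA i))"
        using U(1) by (intro hausdorff_content_le dle) auto
      moreover have "hausdorff_content n \<delta> B \<le> (\<Sum>i. diam_pow n (?UB i))"
        using U(2) by (intro hausdorff_content_le dle) auto
      ultimately show "hausdorff_content n \<delta> A + hausdorff_content n \<delta> B \<le> (\<Sum>i. diam_pow n (U i))"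
        by (metis add_mono order_trans)
    qed
    then show ?thesis using hausdorff_content_le_outer[OF \<open>0 < d\<close>] order_trans by blast
  qed
  have ne: "{0::ennreal<..} \<noteq> {}"
    using zero_less_one by blast
  have "hausdorff_content n \<delta> A + hausdorff_content n \<delta>' B \<le> hausdorff_outer n (A \<union> B)"
    if "0 < \<delta>" "0 < \<delta>'" for \<delta> \<delta>'
    using *[of "min \<delta> \<delta>'"] that
      add_mono[OF hausdorff_content_antimono[of "min \<delta> \<delta>'" \<delta> n A] hausdorff_content_antimono[of "min \<delta> \<delta>'" \<delta>' n B]]
    by (auto intro: order_trans)
  then show ?thesis
    unfolding hausdorff_outer_def[of n A] hausdorff_outer_def[of n B]
    by (subst ennreal_SUP_add_left[OF ne, symmetric], intro SUP_least,
        subst ennreal_SUP_add_right[OF ne], intro SUP_least) auto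
qed

text \<open>Caratheodory's criterion: closed sets are measurable.\<close>

lemma closed_hausdorff_measurable:
  fixes F T :: "'a::metric_space set"
  assumes F: "closed F"
  shows "hausdorff_outer n (T \<inter> F) + hausdorff_outer n (T - F) \<le> hausdorff_outer n T"
proof (cases "F = {} \<or> hausdorff_outer n T = top")
  case True
  then show ?thesis by auto
next
  case False
  then have Fne: "F \<noteq> {}" and fin: "hausdorff_outer n T \<noteq> top" by auto
  let ?H = "hausdorff_outer n :: 'a set \<Rightarrow> ennreal"
  define B where "B k = {x \<in> T. 1 / Suc k \<le> infdist x F}" for k
  define R where "R k = {x \<in> T. 1 / Suc (Suc k) \<le> infdist x F \<and> infdist x F < 1 / Suc k}" for k
  have dist_ge: "infdist x F - infdist y F \<le> dist x y" for x y
    using infdist_triangle[of x F y] by simp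
  have BF: "?H (T \<inter> F) + ?H (B k) \<le> ?H T" for k
  proof -
    have "?H (T \<inter> F) + ?H (B k) \<le> ?H (T \<inter> F \<union> B k)"
    proof (rule hausdorff_outer_separated[of "1 / Suc k"])
      fix x y assume "x \<in> T \<inter> F" "y \<in> B k"
      then show "1 / Suc k \<le> dist x y"
        using dist_ge[of y x] infdist_zero[of x F] by (auto simp: B_def dist_commute)
    qed auto
    also have "\<dots> \<le> ?H T" by (intro hausdorff_outer_mono) (auto simp: B_def)
    finally show ?thesis .
  qed
  have sep: "?H (\<Union>i<m. R (2 * i + c)) \<ge> (\<Sum>i<m. ?H (R (2 * i + c)))" for m c
  proof (induction m)
    case (Suc m)
    have "?H (\<Union>i<m. R (2 * i + c)) + ?H (R (2 * m + c)) \<le> ?H ((\<Union>i<m. R (2 * i + c)) \<union> R (2 * m + c))"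
    proof (cases "m = 0")
      case False
      define e where "e = 1 / real (2 * m + c) - 1 / real (Suc (2 * m + c))"
      have e: "e > 0" unfolding e_def using False by (simp add: frac_less2)
      show ?thesis
      proof (rule hausdorff_outer_separated[OF e])
        fix x y assume "x \<in> (\<Union>i<m. R (2 * i + c))" "y \<in> R (2 * m + c)"
        then obtain i where i: "i < m" "1 / Suc (Suc (2 * i + c)) \<le> infdist x F"
          and y: "infdist y F < 1 / Suc (2 * m + c)" by (auto simp: R_def)
        have "1 / real (2 * m + c) \<le> 1 / Suc (Suc (2 * i + c))"
          using i by (intro divide_left_mono) (auto simp del: of_nat_Suc)
        then show "e \<le> dist x y"
          using i y dist_ge[of x y] unfolding e_def by linarith
      qed
    qed auto
    moreover have "(\<Union>i<Suc m. R (2 * i + c)) = (\<Union>i<m. R (2 * i + c)) \<union> R (2 * m + c)"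
      by (auto simp: less_Suc_eq)
    ultimately show ?case using Suc.IH
      by (simp add: add_right_mono order_trans[OF add_right_mono])
  qed auto
  have parity: "(\<Sum>i. ?H (R (2 * i + c))) \<le> ?H T" for c
  proof (rule suminf_le_const)
    fix m
    have "(\<Union>i<m. R (2 * i + c)) \<subseteq> T" by (auto simp: R_def)
    then show "(\<Sum>i<m. ?H (R (2 * i + c))) \<le> ?H T"
      using sep[where m = m and c = c] hausdorff_outer_mono order_trans by blast
  qed auto
  have "(\<Sum>i<m. ?H (R i)) \<le> ?H T + ?H T" for m
  proof -
    have "(\<Sum>i<m. ?H (R i)) \<le> (\<Sum>i<2*m. ?H (R i))" by (intro sum_mono2) auto
    also have "\<dots> = (\<Sum>i<m. ?H (R (2 * i + 0))) + (\<Sum>i<m. ?H (R (2 * i + 1)))"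
      by (induction m) (auto simp: algebra_simps)
    also have "\<dots> \<le> ?H T + ?H T"
      by (intro add_mono order_trans[OF sum_le_suminf parity]) auto
    finally show ?thesis .
  qed
  then have "(\<Sum>i. ?H (R i)) \<le> ?H T + ?H T"
    by (intro suminf_le_const) auto
  then have finR: "(\<Sum>i. ?H (R i)) \<noteq> top"
    using fin by (auto simp: top_unique)
  have TF: "?H (T - F) \<le> ?H (B k) + (\<Sum>i. ?H (R (i + k)))" for k
  proof -
    have "T - F \<subseteq> B k \<union> (\<Union>i. R (i + k))"
    proof
      fix x assume x: "x \<in> T - F"
      then have pos: "infdist x F > 0"
        using F Fne in_closed_iff_infdist_zero[of F x] infdist_nonneg[of x F] by auto
      show "x \<in> B k \<union> (\<Union>i. R (i + k))"
      proof (cases "1 / Suc k \<le> infdist x F")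
        case True then show ?thesis using x by (auto simp: B_def)
      next
        case False
        define P where "P j \<longleftrightarrow> 1 / real (Suc (j + k)) \<le> infdist x F" for j
        obtain N where "1 / real (Suc N) < infdist x F"
          using nat_approx_posE[OF pos] by blast
        moreover have "1 / real (Suc (N + k)) \<le> 1 / real (Suc N)"
          by (intro divide_left_mono) auto
        ultimately have "P N" unfolding P_def by linarith
        moreover have "\<not> P 0" using False by (simp add: P_def)
        ultimately have "\<exists>j. \<not> P j \<and> P (Suc j)"
          by (induction N) auto
        then obtain j where j: "\<not> P j" "P (Suc j)" by blast
        have "x \<in> R (j + k)" using j x by (auto simp: P_def R_def)
        then show ?thesis by blast
      qed
    qed
    then have "?H (T - F) \<le> ?H (B k \<union> (\<Union>i. R (i + k)))" by (rule hausdorff_outer_mono)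
    also have "\<dots> \<le> ?H (B k) + ?H (\<Union>i. R (i + k))" by (rule hausdorff_outer_Un)
    also have "\<dots> \<le> ?H (B k) + (\<Sum>i. ?H (R (i + k)))" by (intro add_left_mono hausdorff_outer_UN)
    finally show ?thesis .
  qed
  have "(\<lambda>k. ?H T + (\<Sum>i. ?H (R (i + k)))) \<longlonglongrightarrow> ?H T + 0"
  proof (intro tendsto_add tendsto_const)
    have "?H (R i) \<noteq> top" for i
      using hausdorff_outer_mono[of "R i" T n] fin by (auto simp: R_def top_unique)
    then have real: "?H (R i) = ennreal (enn2real (?H (R i)))" for i
      by (metis ennreal_enn2real less_top)
    have summ: "summable (\<lambda>i. enn2real (?H (R i)))"
      using finR by (subst (asm) real) (auto intro: summable_suminf_not_top)
    have "(\<Sum>i. ?H (R (i + k))) = ennreal (\<Sum>i. enn2real (?H (R (i + k))))" for k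
      by (subst real, subst suminf_ennreal2) (use summ in \<open>auto simp: summable_iff_shift[of "\<lambda>i. enn2real (?H (R i))" k]\<close>)
    moreover have "(\<lambda>k. \<Sum>i. enn2real (?H (R (i + k)))) \<longlonglongrightarrow> 0"
      using summ by (rule suminf_exist_split2)
    ultimately show "(\<lambda>k. \<Sum>i. ?H (R (i + k))) \<longlonglongrightarrow> 0"
      by (auto simp flip: ennreal_0)
  qed
  moreover have "?H (T \<inter> F) + ?H (T - F) \<le> ?H T + (\<Sum>i. ?H (R (i + k)))" for k
  proof -
    have "?H (T \<inter> F) + ?H (T - F) \<le> (?H (T \<inter> F) + ?H (B k)) + (\<Sum>i. ?H (R (i + k)))"
      unfolding add.assoc by (intro add_left_mono TF)
    also have "\<dots> \<le> ?H T + (\<Sum>i. ?H (R (i + k)))" by (intro add_right_mono BF)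
    finally show ?thesis .
  qed
  ultimately show ?thesis
    by (metis (no_types, lifting) LIMSEQ_le_const add.right_neutral)
qed

lemma borel_subset_lambda_system_hausdorff:
  "sets (borel :: 'a::metric_space measure) \<subseteq> lambda_system UNIV (Pow UNIV) (hausdorff_outer n)"
proof -
  interpret P: sigma_algebra UNIV "Pow UNIV :: 'a set set" by (rule sigma_algebra_Pow)
  have "measure_space UNIV (lambda_system UNIV (Pow UNIV) (hausdorff_outer n :: 'a set \<Rightarrow> ennreal))
      (hausdorff_outer n)"
    by (rule P.caratheodory_lemma[OF outer_measure_space_hausdorff])
  then interpret L: sigma_algebra UNIV "lambda_system UNIV (Pow UNIV) (hausdorff_outer n :: 'a set \<Rightarrow> ennreal)"
    by (simp add: measure_space_def)
  have "Collect closed \<subseteq> lambda_system UNIV (Pow UNIV) (hausdorff_outer n :: 'a set \<Rightarrow> ennreal)"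
    unfolding P.lambda_system_eq
    by (auto intro!: antisym closed_hausdorff_measurable order_trans[OF _ hausdorff_outer_Un] hausdorff_outer_mono)
  then have "sigma_sets UNIV (Collect closed) \<subseteq> lambda_system UNIV (Pow UNIV) (hausdorff_outer n :: 'a set \<Rightarrow> ennreal)"
    by (rule L.sigma_sets_subset)
  then show ?thesis
    by (simp only: borel_eq_closed sets_measure_of Pow_UNIV subset_UNIV)
qed

lemma space_hausdorff_on [simp]: "space (hausdorff_on n E) = E"
  unfolding hausdorff_on_def
  by (rule space_measure_of) (auto simp: sets_restrict_space)

lemma sets_hausdorff_on [simp]: "sets (hausdorff_on n E) = sets (restrict_space borel E)"
  unfolding hausdorff_on_def
  using sets.sets_measure_of_eq[of "restrict_space borel E"] by (simp add: space_restrict_space)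

lemma emeasure_hausdorff_on:
  fixes E :: "'a::metric_space set"
  assumes "A \<in> sets borel"
  shows "emeasure (hausdorff_on n E) (A \<inter> E) = hausdorff_outer n (A \<inter> E)"
proof (rule emeasure_measure_of[OF hausdorff_on_def])
  let ?L = "lambda_system UNIV (Pow UNIV) (hausdorff_outer n :: 'a set \<Rightarrow> ennreal)"
  interpret P: sigma_algebra UNIV "Pow UNIV :: 'a set set" by (rule sigma_algebra_Pow)
  show "countably_additive (sets (hausdorff_on n E)) (hausdorff_outer n)"
  proof (rule countably_additiveI)
    fix X :: "nat \<Rightarrow> 'a set"
    assume X: "range X \<subseteq> sets (hausdorff_on n E)" and disj: "disjoint_family X"
    have "\<exists>Y\<in>sets borel. X i = E \<inter> Y" for i
      using X by (auto simp: sets_restrict_space)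
    then obtain Y where Y: "\<And>i. Y i \<in> sets borel" "\<And>i. X i = E \<inter> Y i" by metis
    have Dj: "disjointed Y i \<in> sets borel" for i
      using sets.range_disjointed_sets[of Y borel] Y(1) by auto
    have X_eq: "X i = E \<inter> disjointed Y i" for i
    proof -
      have "E \<inter> Y i \<inter> (E \<inter> Y j) = {}" if "j < i" for j
        using disj that Y(2) unfolding disjoint_family_on_def by (metis UNIV_I less_irrefl)
      then show ?thesis unfolding Y(2) disjointed_def by fastforce
    qed
    have pos: "positive (Pow UNIV) (hausdorff_outer n :: 'a set \<Rightarrow> ennreal)"
      by (simp add: positive_def)
    have part: "(\<Sum>i<m. hausdorff_outer n (X i)) \<le> hausdorff_outer n (\<Union>i. X i)" for m
    proof -
      have "(\<Sum>i = 0..<m. hausdorff_outer n (E \<inter> disjointed Y i)) =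
          hausdorff_outer n (E \<inter> (\<Union>i\<in>{0..<m}. disjointed Y i))"
        using Dj borel_subset_lambda_system_hausdorff
        by (intro P.lambda_system_strong_sum pos disjoint_family_disjointed) auto
      also have "\<dots> \<le> hausdorff_outer n (\<Union>i. X i)"
        by (intro hausdorff_outer_mono) (auto simp: X_eq)
      finally show ?thesis by (simp add: X_eq lessThan_atLeast0)
    qed
    show "(\<Sum>i. hausdorff_outer n (X i)) = hausdorff_outer n (\<Union>i. X i)"
      by (intro antisym hausdorff_outer_UN suminf_le_const part) auto
  qed
qed (use assms in \<open>auto simp: sets_restrict_space positive_def\<close>)


definition ahlfors_david_regular :: "nat \<Rightarrow> 'a::metric_space set \<Rightarrow> bool" where
  "ahlfors_david_regular n E \<longleftrightarrow>
     (\<exists>C1 C2 :: real. 0 < C1 \<and> C1 \<le> C2 \<and>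
        (\<forall>x\<in>E. \<forall>r>0. ennreal r \<le> ediam E \<longrightarrow>
           ennreal (C1 * r ^ n) \<le> hausdorff_outer n (E \<inter> cball x r) \<and>
           hausdorff_outer n (E \<inter> cball x r) \<le> ennreal (C2 * r ^ n)))"

definition lipschitz_graph :: "nat \<Rightarrow> real \<Rightarrow> 'a::euclidean_space set \<Rightarrow> bool" where
  "lipschitz_graph n M \<Gamma> \<longleftrightarrow>
     (\<exists>P A. subspace P \<and> dim P = n \<and> A \<in> P \<rightarrow> P\<^sup>\<bottom> \<and> M-lipschitz_on P A \<and>
        \<Gamma> = (\<lambda>p. p + A p) ` P)"

definition big_pieces_lipschitz_graphs :: "nat \<Rightarrow> real \<Rightarrow> real \<Rightarrow> 'a::euclidean_space set \<Rightarrow> bool" where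
  "big_pieces_lipschitz_graphs n M \<delta> E \<longleftrightarrow>
     (\<forall>x\<in>E. \<forall>r>0. ennreal r \<le> ediam E \<longrightarrow>
        (\<exists>\<Gamma>. lipschitz_graph n M \<Gamma> \<and>
             ennreal (\<delta> * r ^ n) \<le> hausdorff_outer n (E \<inter> \<Gamma> \<inter> cball x r)))"


definition orth_proj :: "'a::euclidean_space set \<Rightarrow> 'a \<Rightarrow> 'a" where
  "orth_proj V x = (THE y. y \<in> V \<and> x - y \<in> V\<^sup>\<bottom>)"

lemma orth_proj_unique:
  fixes V :: "'a::euclidean_space set"
  assumes V: "subspace V"
  shows "\<exists>!y. y \<in> V \<and> x - y \<in> V\<^sup>\<bottom>"
proof (rule ex_ex1I)
  obtain y z where "y \<in> span V" "\<And>w. w \<in> span V \<Longrightarrow> orthogonal z w" "x = y + z"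
    using orthogonal_subspace_decomp_exists[of V x] by blast
  then have "y \<in> V \<and> x - y \<in> V\<^sup>\<bottom>"
    using span_eq_iff[THEN iffD2, OF V] by (auto simp: orthogonal_comp_def orthogonal_commute)
  then show "\<exists>y. y \<in> V \<and> x - y \<in> V\<^sup>\<bottom>" ..
next
  fix y y' assume y: "y \<in> V \<and> x - y \<in> V\<^sup>\<bottom>" "y' \<in> V \<and> x - y' \<in> V\<^sup>\<bottom>"
  then have "y - y' \<in> V" using V by (simp add: subspace_diff)
  then have "(y - y') \<bullet> (x - y) = 0" "(y - y') \<bullet> (x - y') = 0"
    using y by (auto simp: orthogonal_comp_def orthogonal_def)
  then have "(y - y') \<bullet> (y - y') = 0"
    by (simp add: inner_diff_right)
  then show "y = y'" by simp
qed

definition grassmannian :: "nat \<Rightarrow> 'a::euclidean_space set set" where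
  "grassmannian k = {V. subspace V \<and> dim V = k}"

definition grassmann_dist :: "'a::euclidean_space set \<Rightarrow> 'a set \<Rightarrow> real" where
  "grassmann_dist V W = onorm (\<lambda>x. orth_proj V x - orth_proj W x)"

definition grassmann_cball :: "nat \<Rightarrow> 'a::euclidean_space set \<Rightarrow> real \<Rightarrow> 'a set set" where
  "grassmann_cball k V r = {W \<in> grassmannian k. grassmann_dist V W \<le> r}"

definition proj_push :: "nat \<Rightarrow> 'a::euclidean_space set \<Rightarrow> 'a set \<Rightarrow> 'a measure" where
  "proj_push n V E = distr (hausdorff_on n E) (hausdorff_on n V) (orth_proj V)"

text \<open>\<open>\<mu>\<close> belongs to \<open>L\<^sup>\<infinity>(\<nu>)\<close> with norm at most \<open>C\<close>. Densities of measures are nonnegative, so the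
  norm is the essential supremum.\<close>

definition Linfty_norm_le :: "'a measure \<Rightarrow> 'a measure \<Rightarrow> real \<Rightarrow> bool" where
  "Linfty_norm_le \<nu> \<mu> C \<longleftrightarrow>
     absolutely_continuous \<nu> \<mu> \<and>
     (\<exists>f \<in> borel_measurable \<nu>. density \<nu> f = \<mu> \<and> esssup \<nu> f \<le> ennreal C)"

end

theory Submission
  imports Defs
begin

text \<open>If \<open>\<Gamma>\<close> is an \<open>M\<close>-Lipschitz graph over \<open>P\<close>, then \<open>\<pi>\<^sub>P\<close> contracts distances on \<open>\<Gamma>\<close> by at most
  the factor \<open>1 + M\<close>, and by perturbation \<open>\<pi>\<^sub>V\<close> does so by at most \<open>2 (1 + M)\<close> whenever
  \<open>\<parallel>\<pi>\<^sub>V - \<pi>\<^sub>P\<parallel> \<le> 1 / (2 (1 + M))\<close>. Hence the push-forward of \<open>\<H>\<^sup>n\<close> restricted to any subset of \<open>\<Gamma>\<close>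
  is bounded by \<open>(2 (1 + M))\<^sup>n \<H>\<^sup>n\<close> on \<open>V\<close>. As \<open>\<H>\<^sup>n\<close> is \<open>\<sigma>\<close>-finite on \<open>V\<close>, the Radon-Nikodym theorem
  turns this domination into a bound on the density. So \<open>E\<^sub>x\<^sub>,\<^sub>r = E \<inter> \<Gamma>\<^sub>x\<^sub>,\<^sub>r \<inter> B(x,r)\<close> works with
  \<open>V\<^sub>x\<^sub>,\<^sub>r = P\<close>.\<close>

section \<open>Covers, and Hausdorff measure under expanding maps\<close>

lemma ediam_le_iff: "ediam A \<le> c \<longleftrightarrow> (\<forall>x\<in>A. \<forall>y\<in>A. ennreal (dist x y) \<le> c)"
  unfolding ediam_def by (simp add: SUP_le_iff)

text \<open>\<open>hausdorff_content\<close> only admits sequences, so a finite cover is padded with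
  empty sets, which cost 0 even for \<open>n = 0\<close>.\<close>

lemma hausdorff_content_le_sum:
  assumes "finite I" and "A \<subseteq> (\<Union>i\<in>I. U i)" and "\<And>i. i \<in> I \<Longrightarrow> ediam (U i) \<le> \<delta>"
  shows "hausdorff_content n \<delta> A \<le> (\<Sum>i\<in>I. diam_pow n (U i))"
proof -
  obtain h where h: "bij_betw h {0..<card I} I"
    using ex_bij_betw_nat_finite[OF assms(1)] by blast
  define W where "W i = (if i < card I then U (h i) else {})" for i
  have "A \<subseteq> (\<Union>i. W i)"
  proof
    fix x assume "x \<in> A"
    then obtain j where "j \<in> I" "x \<in> U j" using assms(2) by blast
    then obtain i where "i < card I" "h i = j"
      using h by (force simp: bij_betw_def)
    with \<open>x \<in> U j\<close> have "x \<in> W i" by (simp add: W_def)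
    then show "x \<in> (\<Union>i. W i)" by blast
  qed
  moreover have "ediam (W i) \<le> \<delta>" for i
    using assms(3) bij_betwE[OF h] by (simp add: W_def)
  ultimately have "hausdorff_content n \<delta> A \<le> (\<Sum>i. diam_pow n (W i))"
    by (rule hausdorff_content_le)
  also have "\<dots> = (\<Sum>i\<in>{0..<card I}. diam_pow n (W i))"
    by (rule suminf_finite) (auto simp: W_def)
  also have "\<dots> = (\<Sum>i\<in>{0..<card I}. diam_pow n (U (h i)))"
    by (intro sum.cong) (auto simp: W_def)
  also have "\<dots> = (\<Sum>i\<in>I. diam_pow n (U i))"
    by (rule sum.reindex_bij_betw[OF h])
  finally show ?thesis .
qed

text \<open>Covers of the image pull back along \<open>f\<close> to covers of \<open>A\<close>, and
  pulling back enlarges diameters at most by the factor \<open>L\<close>.\<close>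

lemma hausdorff_outer_le_expanding_image:
  fixes A :: "'a::metric_space set" and f :: "'a \<Rightarrow> 'b::metric_space"
  assumes L: "L > 0" and f: "\<And>x y. x \<in> A \<Longrightarrow> y \<in> A \<Longrightarrow> dist x y \<le> L * dist (f x) (f y)"
  shows "hausdorff_outer n A \<le> ennreal (L ^ n) * hausdorff_outer n (f ` A)"
  unfolding hausdorff_outer_def[of n A]
proof (rule SUP_least)
  fix \<delta> :: ennreal assume "\<delta> \<in> {0<..}"
  then have \<delta>: "0 < \<delta>" by simp
  \<comment> \<open>The scale at which pulled-back sets have diameter at most
    \<open>\<delta>\<close>; an infinite \<open>\<delta>\<close> stays infinite.\<close>
  define \<delta>' where "\<delta>' = ennreal (1 / L) * \<delta>"
  have "\<delta>' > 0" using \<delta> L by (simp add: \<delta>'_def ennreal_zero_less_mult_iff)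
  have L\<delta>: "ennreal L * \<delta>' = \<delta>"
    unfolding \<delta>'_def mult.assoc[symmetric] ennreal_mult[symmetric, OF less_imp_le[OF L] less_imp_le[OF divide_pos_pos[OF zero_less_one L]]]
    using L by simp
  have "hausdorff_content n \<delta> A \<le> ennreal (L ^ n) * (\<Sum>i. diam_pow n (U i))"
    if U: "f ` A \<subseteq> (\<Union>i. U i)" "\<And>i. ediam (U i) \<le> \<delta>'" for U :: "nat \<Rightarrow> 'b set"
  proof -
    let ?W = "\<lambda>i. A \<inter> f -` U i"
    have W: "ediam (?W i) \<le> ennreal L * ediam (U i)" for i
      unfolding ediam_le_iff[of "?W i"]
    proof (intro ballI)
      fix x y assume xy: "x \<in> ?W i" "y \<in> ?W i"
      have "ennreal (dist x y) \<le> ennreal (L * dist (f x) (f y))"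
        using f xy by (intro ennreal_leI) auto
      also have "\<dots> = ennreal L * ennreal (dist (f x) (f y))"
        using L by (simp add: ennreal_mult)
      also have "\<dots> \<le> ennreal L * ediam (U i)"
        using xy by (intro mult_left_mono dist_le_ediam) auto
      finally show "ennreal (dist x y) \<le> ennreal L * ediam (U i)" .
    qed
    have "hausdorff_content n \<delta> A \<le> (\<Sum>i. diam_pow n (?W i))"
    proof (rule hausdorff_content_le)
      show "A \<subseteq> (\<Union>i. ?W i)" using U(1) by blast
      show "ediam (?W i) \<le> \<delta>" for i
        using order_trans[OF W mult_left_mono[OF U(2), of "ennreal L"]] L\<delta> by simp
    qed
    also have "\<dots> \<le> (\<Sum>i. ennreal (L ^ n) * diam_pow n (U i))"
    proof (intro suminf_le)
      fix i
      show "diam_pow n (?W i) \<le> ennreal (L ^ n) * diam_pow n (U i)"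
      \<comment> \<open>For \<open>n = 0\<close> the power of a zero diameter is 1, so the empty
        pullback is treated apart; a nonempty one forces \<open>U i\<close> to be nonempty.\<close>
      proof (cases "?W i = {}")
        case False
        then have "U i \<noteq> {}" by auto
        have "ediam (?W i) ^ n \<le> (ennreal L * ediam (U i)) ^ n"
          using W by (intro power_mono) auto
        then show ?thesis
          using False \<open>U i \<noteq> {}\<close> L by (simp add: diam_pow_def power_mult_distrib ennreal_power)
      qed (simp only: diam_pow_empty zero_le)
    qed auto
    also have "\<dots> = ennreal (L ^ n) * (\<Sum>i. diam_pow n (U i))"
      by simp
    finally show ?thesis .
  qed
  \<comment> \<open>With the factor on the left, the bound is a common lower bound of all competing
    sums and passes to the infimum.\<close>
  then have "hausdorff_content n \<delta> A / ennreal (L ^ n) \<le> hausdorff_content n \<delta>' (f ` A)"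
    unfolding hausdorff_content_def[of n \<delta>'] using L
    by (intro INF_greatest divide_le_posI_ennreal) auto
  then have "hausdorff_content n \<delta> A / ennreal (L ^ n) * ennreal (L ^ n) \<le>
      hausdorff_content n \<delta>' (f ` A) * ennreal (L ^ n)"
    by (rule mult_right_mono) simp
  moreover have "hausdorff_content n \<delta> A / ennreal (L ^ n) * ennreal (L ^ n) = hausdorff_content n \<delta> A"
    unfolding ennreal_divide_times using L by (subst ennreal_divide_self) auto
  ultimately have "hausdorff_content n \<delta> A \<le> ennreal (L ^ n) * hausdorff_content n \<delta>' (f ` A)"
    by (metis mult.commute)
  also have "\<dots> \<le> ennreal (L ^ n) * hausdorff_outer n (f ` A)"
    using \<open>\<delta>' > 0\<close> by (intro mult_left_mono hausdorff_content_le_outer) auto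
  finally show "hausdorff_content n \<delta> A \<le> ennreal (L ^ n) * hausdorff_outer n (f ` A)" .
qed

section \<open>Sigma-finiteness of Hausdorff measure on subspaces\<close>

text \<open>In orthonormal coordinates the ball is covered by \<open>(2 * N + 1) ^ n\<close> grid
  cells of side \<open>R / N\<close>, with \<open>n = dim V\<close>. Each has diameter at most
  \<open>n * R / N\<close>, so the total cost stays bounded as the grid is refined.\<close>

lemma hausdorff_outer_subspace_cball_finite:
  fixes V :: "'a::euclidean_space set"
  assumes V: "subspace V" and R: "R > 0"
  shows "hausdorff_outer (dim V) (V \<inter> cball 0 R) < \<infinity>"
proof -
  let ?n = "dim V"
  obtain B where B: "B \<subseteq> V" "pairwise orthogonal B" "\<And>x. x \<in> B \<Longrightarrow> norm x = 1"
      "independent B" "card B = ?n" "span B = V"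
    using orthonormal_basis_subspace[OF V] by metis
  have fin: "finite B" using B(4) independent_imp_finite by blast
  have norm_le: "norm v \<le> (\<Sum>b\<in>B. \<bar>v \<bullet> b\<bar>)" if "v \<in> V" for v
  proof -
    have "v = (\<Sum>b\<in>B. (v \<bullet> b) *\<^sub>R b)"
      using orthonormal_basis_expand[OF B(2) _ _ fin] B(3,6) that by metis
    then have "norm v \<le> (\<Sum>b\<in>B. norm ((v \<bullet> b) *\<^sub>R b))"
      using norm_sum by metis
    then show ?thesis using B(3) by simp
  qed
  have "hausdorff_content ?n \<delta> (V \<inter> cball 0 R) \<le> ennreal ((3 * ?n * R) ^ ?n)" if \<delta>: "0 < \<delta>" for \<delta>
  proof -
    \<comment> \<open>A finite positive scale below \<open>\<delta>\<close>, which may be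
      infinite.\<close>
    obtain e :: real where e: "e > 0" "ennreal e \<le> \<delta>"
    proof (cases \<delta>)
      case (real r)
      then show ?thesis using that[of r] \<delta> by auto
    next
      case top
      then show ?thesis using that[of 1] by auto
    qed
    \<comment> \<open>Fine enough that cells of side \<open>R / N\<close> have diameter at most
      \<open>e\<close>.\<close>
    obtain N0 :: nat where N0: "?n * R / e < N0" using reals_Archimedean2 by blast
    define N where "N = Suc N0"
    have N: "N > 0" "?n * R / e \<le> N" using N0 by (auto simp: N_def)
    define s where "s = R / N"
    have s: "s > 0" "?n * s \<le> e"
      using N R e by (auto simp: s_def field_simps)
    \<comment> \<open>The half-open grid cell with index \<open>k\<close>. Coordinates in
      \<open>[-R, R]\<close> have floors from \<open>- N\<close> to \<open>N\<close>, the value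
      \<open>N\<close> occurring at the endpoint \<open>R\<close>; hence the
      \<open>2 * N + 1\<close> indices per axis in \<open>I\<close>.\<close>
    define U where "U k = {x \<in> V. \<forall>b\<in>B. \<lfloor>(x \<bullet> b) / s\<rfloor> = k b}" for k :: "'a \<Rightarrow> int"
    define I where "I = Pi\<^sub>E B (\<lambda>_. {- int N..int N})"
    have U: "ediam (U k) \<le> ennreal (?n * s)" for k
      unfolding ediam_le_iff
    proof (intro ballI ennreal_leI)
      fix x y assume xy: "x \<in> U k" "y \<in> U k"
      have "\<bar>(x - y) \<bullet> b\<bar> \<le> s" if "b \<in> B" for b
      proof -
        have "\<lfloor>(x \<bullet> b) / s\<rfloor> = \<lfloor>(y \<bullet> b) / s\<rfloor>" using xy that by (simp add: U_def)
        then have "\<bar>(x \<bullet> b) / s - (y \<bullet> b) / s\<bar> \<le> 1" by linarith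
        then show ?thesis using s by (simp add: inner_diff_left diff_divide_distrib[symmetric] field_simps)
      qed
      moreover have "x - y \<in> V" using xy V by (simp add: U_def subspace_diff)
      ultimately have "norm (x - y) \<le> (\<Sum>b\<in>B. s)"
        using norm_le[of "x - y"] sum_mono[of B "\<lambda>b. \<bar>(x - y) \<bullet> b\<bar>" "\<lambda>_. s"] by force
      then show "dist x y \<le> ?n * s" by (simp add: dist_norm B(5))
    qed
    have cover: "V \<inter> cball 0 R \<subseteq> (\<Union>k\<in>I. U k)"
    proof
      fix x assume x: "x \<in> V \<inter> cball 0 R"
      let ?k = "restrict (\<lambda>b. \<lfloor>(x \<bullet> b) / s\<rfloor>) B"
      have "\<lfloor>(x \<bullet> b) / s\<rfloor> \<in> {- int N..int N}" if "b \<in> B" for b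
      proof -
        have "\<bar>x \<bullet> b\<bar> \<le> R"
          using Cauchy_Schwarz_ineq2[of x b] B(3)[OF that] x by simp
        moreover have "R = N * s" using N by (simp add: s_def)
        ultimately have "\<bar>(x \<bullet> b) / s\<bar> \<le> N"
          using s by (simp add: pos_divide_le_eq)
        then have "- real N \<le> (x \<bullet> b) / s \<and> (x \<bullet> b) / s < real N + 1" by linarith
        then show ?thesis
          by (simp only: atLeastAtMost_iff le_floor_iff floor_le_iff of_int_minus of_int_of_nat_eq)
      qed
      then have "?k \<in> I" by (auto simp: I_def)
      moreover have "x \<in> U ?k" using x by (auto simp: U_def)
      ultimately show "x \<in> (\<Union>k\<in>I. U k)" by blast
    qed
    have "hausdorff_content ?n \<delta> (V \<inter> cball 0 R) \<le> (\<Sum>k\<in>I. diam_pow ?n (U k))"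
      using cover fin
    proof (intro hausdorff_content_le_sum)
      show "ediam (U k) \<le> \<delta>" for k
        using U[of k] ennreal_leI[OF s(2)] e(2) by (auto intro: order_trans)
    qed (auto simp: I_def intro!: finite_PiE)
    also have "\<dots> \<le> (\<Sum>k\<in>I. ennreal ((?n * s) ^ ?n))"
      using s U by (intro sum_mono) (auto simp: diam_pow_def ennreal_power[symmetric] intro!: power_mono)
    also have "\<dots> = ennreal (real (card I) * (?n * s) ^ ?n)"
      using s by (simp add: ennreal_mult ennreal_of_nat_eq_real_of_nat)
    also have "real (card I) = (2 * real N + 1) ^ ?n"
      using fin B(5) by (simp add: I_def card_PiE)
    \<comment> \<open>Since \<open>N\<close> is at least 1; the powers of \<open>N\<close> then
      cancel against \<open>s = R / N\<close>, leaving a bound free of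
      \<open>\<delta>\<close>.\<close>
    also have "(2 * real N + 1) ^ ?n * (?n * s) ^ ?n \<le> (3 * real N) ^ ?n * (?n * s) ^ ?n"
      using N s by (intro mult_right_mono power_mono) auto
    also have "\<dots> = (3 * ?n * R) ^ ?n"
      using N(1) by (simp add: s_def power_mult_distrib power_divide)
    finally show ?thesis by (simp add: ennreal_leI)
  qed
  then have "hausdorff_outer ?n (V \<inter> cball 0 R) \<le> ennreal ((3 * ?n * R) ^ ?n)"
    unfolding hausdorff_outer_def by (intro SUP_least) auto
  then show ?thesis using ennreal_less_top order_le_less_trans by (metis infinity_ennreal_def)
qed

text \<open>Balls of radius 1, 2, ... exhaust \<open>V\<close> and have finite measure; this makes
  Radon-Nikodym applicable on \<open>V\<close>.\<close>

lemma sigma_finite_hausdorff_on_subspace: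
  fixes V :: "'a::euclidean_space set"
  assumes V: "subspace V"
  shows "sigma_finite_measure (hausdorff_on (dim V) V)"
proof
  let ?A = "range (\<lambda>m::nat. cball 0 (real (Suc m)) \<inter> V)"
  have "(\<Union>?A) = V"
  proof -
    have "x \<in> \<Union>?A" if x: "x \<in> V" for x
    proof -
      obtain m :: nat where "norm x < m" using reals_Archimedean2 by blast
      then have "x \<in> cball 0 (real (Suc m)) \<inter> V" using x by simp
      then show ?thesis by blast
    qed
    then show ?thesis by auto
  qed
  moreover have "emeasure (hausdorff_on (dim V) V) (cball 0 (real (Suc m)) \<inter> V) \<noteq> \<infinity>" for m
    using hausdorff_outer_subspace_cball_finite[OF V, of "real (Suc m)"]
    by (subst emeasure_hausdorff_on) (auto simp: Int_commute)
  moreover have "?A \<subseteq> sets (hausdorff_on (dim V) V)"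
    by (auto simp: sets_restrict_space)
  ultimately show "\<exists>A. countable A \<and> A \<subseteq> sets (hausdorff_on (dim V) V) \<and>
      \<Union>A = space (hausdorff_on (dim V) V) \<and> (\<forall>a\<in>A. emeasure (hausdorff_on (dim V) V) a \<noteq> \<infinity>)"
    by (intro exI[of _ ?A]) auto
qed

section \<open>From domination of measures to bounded densities\<close>

text \<open>Where the density exceeds \<open>C\<close>, domination still bounds its integral by that
  of \<open>C\<close>. So replacing \<open>C\<close> by the maximum of the two leaves the measure
  unchanged, and uniqueness of densities forces the maximum to be \<open>C\<close> almost
  everywhere.\<close>

lemma (in sigma_finite_measure) Linfty_norm_le_if_dominated:
  assumes sets: "sets N = sets M"
    and le: "\<And>A. A \<in> sets M \<Longrightarrow> emeasure N A \<le> ennreal C * emeasure M A"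
  shows "Linfty_norm_le M N C"
proof -
  have ac: "absolutely_continuous M N"
    unfolding absolutely_continuous_def
  proof
    fix A assume "A \<in> null_sets M"
    then show "A \<in> null_sets N" using le[of A] sets by (auto simp: null_sets_def)
  qed
  obtain f where f: "f \<in> borel_measurable M" "density M f = N"
    using Radon_Nikodym[OF ac sets] by blast
  \<comment> \<open>Comparing two densities avoids subtracting integrals that may be
    infinite.\<close>
  let ?g = "\<lambda>x. max (f x) (ennreal C)"
  have "emeasure (density M ?g) A = emeasure (density M (\<lambda>_. ennreal C)) A" if A: "A \<in> sets M" for A
  proof (rule antisym)
    \<comment> \<open>Splitting \<open>A\<close> along \<open>S\<close>: the maximum is
      \<open>f\<close> on \<open>S\<close>, where it integrates to \<open>N\<close>, and
      \<open>C\<close> off \<open>S\<close>.\<close>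
    define S where "S = {x \<in> space M. ennreal C < f x}"
    have S[measurable]: "S \<in> sets M" using f(1) unfolding S_def by measurable
    note [measurable] = f(1) A
    have "emeasure (density M ?g) A = (\<integral>\<^sup>+x. f x * indicator (A \<inter> S) x + ennreal C * indicator (A - S) x \<partial>M)"
      by (subst emeasure_density) (auto intro!: nn_integral_cong simp: S_def max_def split: split_indicator)
    also have "\<dots> = emeasure N (A \<inter> S) + ennreal C * emeasure M (A - S)"
      by (subst nn_integral_add) (auto simp: f(2)[symmetric] emeasure_density nn_integral_cmult_indicator)
    also have "\<dots> \<le> ennreal C * emeasure M (A \<inter> S) + ennreal C * emeasure M (A - S)"
      using le by (intro add_right_mono) auto
    also have "\<dots> = ennreal C * emeasure M A"
      unfolding distrib_left[symmetric]
      by (subst plus_emeasure) (auto simp: Int_Diff_Un)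
    finally show "emeasure (density M ?g) A \<le> emeasure (density M (\<lambda>_. ennreal C)) A"
      by (simp add: emeasure_density nn_integral_cmult_indicator)
    show "emeasure (density M (\<lambda>_. ennreal C)) A \<le> emeasure (density M ?g) A"
      by (auto simp: emeasure_density intro!: nn_integral_mono mult_right_mono)
  qed
  then have "density M ?g = density M (\<lambda>_. ennreal C)"
    by (intro measure_eqI) auto
  then have "AE x in M. ?g x = ennreal C"
    using f(1) by (intro density_unique) auto
  then have "AE x in M. f x \<le> ennreal C"
    by eventually_elim (simp add: max_def split: if_splits)
  then have "esssup M f \<le> ennreal C"
    using f(1) by (intro esssup_I) auto
  then show ?thesis using ac f unfolding Linfty_norm_le_def by blast
qed

section \<open>Orthogonal projections and their restriction to Lipschitz graphs\<close>

lemma orth_proj_in: "subspace V \<Longrightarrow> orth_proj V x \<in> V"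
  and orth_proj_diff: "subspace V \<Longrightarrow> x - orth_proj V x \<in> V\<^sup>\<bottom>"
  using theI'[OF orth_proj_unique[of V x]] by (auto simp: orth_proj_def)

lemma orth_proj_eqI: "subspace V \<Longrightarrow> y \<in> V \<Longrightarrow> x - y \<in> V\<^sup>\<bottom> \<Longrightarrow> orth_proj V x = y"
  using orth_proj_unique[of V x] orth_proj_in[of V x] orth_proj_diff[of V x] by blast

lemma bounded_linear_orth_proj:
  assumes V: "subspace V"
  shows "bounded_linear (orth_proj V)"
  unfolding linear_conv_bounded_linear[symmetric]
proof (rule linearI)
  have V': "subspace (V\<^sup>\<bottom>)" by (rule subspace_orthogonal_comp)
  show "orth_proj V (x + y) = orth_proj V x + orth_proj V y" for x y
    using orth_proj_in[OF V] subspace_add[OF V' orth_proj_diff[OF V, of x] orth_proj_diff[OF V, of y]]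
    by (intro orth_proj_eqI V) (auto simp: subspace_add V algebra_simps)
  show "orth_proj V (c *\<^sub>R x) = c *\<^sub>R orth_proj V x" for c x
    using orth_proj_in[OF V] subspace_scale[OF V' orth_proj_diff[OF V, of x], of c]
    by (intro orth_proj_eqI V) (auto simp: subspace_scale V scaleR_diff_right)
qed

text \<open>\<open>onorm\<close> is a real supremum, which gives a pointwise bound because both
  projections are bounded linear maps.\<close>

lemma norm_orth_proj_diff_le:
  assumes "subspace V" "subspace W"
  shows "norm (orth_proj V x - orth_proj W x) \<le> grassmann_dist V W * norm x"
  unfolding grassmann_dist_def
  by (intro onorm bounded_linear_sub bounded_linear_orth_proj assms)

text \<open>Projecting to \<open>P\<close> keeps at least the fraction \<open>1 / (1 + M)\<close> of
  a distance in the graph. Tilting \<open>P\<close> to \<open>V\<close> costs at most half of that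
  fraction, and the other half survives.\<close>

lemma orth_proj_expanding_on_graph:
  fixes P V :: "'a::euclidean_space set"
  assumes P: "subspace P" and A: "A \<in> P \<rightarrow> P\<^sup>\<bottom>" "M-lipschitz_on P A"
    and V: "subspace V" "grassmann_dist P V \<le> 1 / (2 * (1 + M))"
    and xy: "x \<in> (\<lambda>p. p + A p) ` P" "y \<in> (\<lambda>p. p + A p) ` P"
  shows "dist x y \<le> 2 * (1 + M) * dist (orth_proj V x) (orth_proj V y)"
proof -
  obtain p q where pq: "p \<in> P" "x = p + A p" "q \<in> P" "y = q + A q" using xy by auto
  have M: "M \<ge> 0" using A(2) by (rule lipschitz_on_nonneg)
  have lin: "linear (orth_proj P)" "linear (orth_proj V)"
    using bounded_linear_orth_proj P V(1) bounded_linear.linear by blast+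
  \<comment> \<open>The component \<open>A p\<close> is orthogonal to \<open>P\<close>, so
    projecting recovers the base point.\<close>
  have "orth_proj P x = p" "orth_proj P y = q"
    using A(1) pq by (auto intro!: orth_proj_eqI P)
  then have Pxy: "orth_proj P (x - y) = p - q" by (simp add: linear_diff[OF lin(1)])
  have "dist x y \<le> dist p q + dist (A p) (A q)"
    unfolding pq by (rule dist_triangle_add)
  also have "\<dots> \<le> (1 + M) * norm (p - q)"
    using lipschitz_onD[OF A(2) pq(1,3)] by (simp add: dist_norm algebra_simps)
  finally have 1: "dist x y \<le> (1 + M) * norm (p - q)" .
  have "norm (p - q) \<le> norm (orth_proj V (x - y)) + norm (orth_proj P (x - y) - orth_proj V (x - y))"
    unfolding Pxy by (rule norm_triangle_sub)
  also have "norm (orth_proj P (x - y) - orth_proj V (x - y)) \<le> grassmann_dist P V * norm (x - y)"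
    by (rule norm_orth_proj_diff_le[OF P V(1)])
  also have "\<dots> \<le> 1 / (2 * (1 + M)) * dist x y"
    unfolding dist_norm using V(2) by (intro mult_right_mono) auto
  finally have "(1 + M) * norm (p - q) \<le> (1 + M) * (norm (orth_proj V (x - y)) + 1 / (2 * (1 + M)) * dist x y)"
    using M by (intro mult_left_mono) auto
  \<comment> \<open>The error has become half of \<open>dist x y\<close>, which is absorbed into the
    left side of the bound \<open>1\<close>.\<close>
  also have "\<dots> = (1 + M) * norm (orth_proj V (x - y)) + dist x y / 2"
    using M by (simp add: field_simps)
  finally show ?thesis
    using 1 unfolding linear_diff[OF lin(2)] dist_norm[of "orth_proj V x"] by linarith
qed

text \<open>The projection sends the part of \<open>S\<close> over \<open>A\<close> into
  \<open>A\<close>, so expansion bounds the measure of that part by \<open>L ^ n\<close> times that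
  of \<open>A\<close>. A separate \<open>C\<close> lets one constant serve this bound and the size
  of the piece.\<close>

lemma Linfty_norm_le_proj_push:
  fixes V S :: "'a::euclidean_space set"
  assumes V: "subspace V" "dim V = n" and L: "L > 0"
    and S: "\<And>x y. x \<in> S \<Longrightarrow> y \<in> S \<Longrightarrow> dist x y \<le> L * dist (orth_proj V x) (orth_proj V y)"
    and C: "L ^ n \<le> C"
  shows "Linfty_norm_le (hausdorff_on n V) (proj_push n V S) C"
proof -
  interpret sigma_finite_measure "hausdorff_on n V"
    using sigma_finite_hausdorff_on_subspace[OF V(1)] V(2) by simp
  have borel: "orth_proj V \<in> borel_measurable borel"
    using bounded_linear_orth_proj[OF V(1)]
    by (intro borel_measurable_continuous_onI) (rule linear_continuous_on)
  have meas: "orth_proj V \<in> hausdorff_on n S \<rightarrow>\<^sub>M hausdorff_on n V"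
  proof -
    have "orth_proj V \<in> restrict_space borel S \<rightarrow>\<^sub>M restrict_space borel V"
      using borel orth_proj_in[OF V(1)] by (intro measurable_restrict_space3) auto
    then show ?thesis by (simp cong: measurable_cong_sets)
  qed
  show ?thesis
  proof (rule Linfty_norm_le_if_dominated)
    show "sets (proj_push n V S) = sets (hausdorff_on n V)" by (simp add: proj_push_def)
    fix A assume A: "A \<in> sets (hausdorff_on n V)"
    then obtain Y where Y: "Y \<in> sets borel" "A = Y \<inter> V"
      by (auto simp: sets_restrict_space)
    let ?T = "orth_proj V -` Y \<inter> S"
    have pre: "orth_proj V -` Y \<in> sets borel"
      using measurable_sets[OF borel Y(1)] by simp
    have "emeasure (proj_push n V S) A = emeasure (hausdorff_on n S) (orth_proj V -` A \<inter> S)"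
      unfolding proj_push_def using meas A by (subst emeasure_distr) auto
    \<comment> \<open>All projected points lie in \<open>V\<close>, so \<open>A\<close> may be
      replaced by the Borel set \<open>Y\<close>, the form that \<open>emeasure_hausdorff_on\<close>
      requires.\<close>
    also have "orth_proj V -` A \<inter> S = ?T"
      using orth_proj_in[OF V(1)] by (auto simp: Y)
    also have "emeasure (hausdorff_on n S) ?T = hausdorff_outer n ?T"
      by (rule emeasure_hausdorff_on[OF pre])
    also have "\<dots> \<le> ennreal (L ^ n) * hausdorff_outer n (orth_proj V ` ?T)"
      using S by (intro hausdorff_outer_le_expanding_image L) auto
    also have "\<dots> \<le> ennreal C * hausdorff_outer n (Y \<inter> V)"
      using orth_proj_in[OF V(1)] C by (intro mult_mono hausdorff_outer_mono ennreal_leI) auto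
    also have "\<dots> = ennreal C * emeasure (hausdorff_on n V) A"
      using Y by (simp add: emeasure_hausdorff_on)
    finally show "emeasure (proj_push n V S) A \<le> ennreal C * emeasure (hausdorff_on n V) A" .
  qed
qed

section \<open>Choice of constants, centres and pieces\<close>

theorem proposition1p4:
  fixes n :: nat and M \<delta> :: real
  assumes "1 \<le> n" and "n < DIM('a::euclidean_space)" and "0 < \<delta>"
  shows "\<exists>\<rho>>0. \<exists>C>0. \<forall>E :: 'a set.
           ahlfors_david_regular n E \<longrightarrow> big_pieces_lipschitz_graphs n M \<delta> E \<longrightarrow>
           (\<forall>x\<in>E. \<forall>r>0. ennreal r \<le> ediam E \<longrightarrow>
              (\<exists>V0 \<in> grassmannian n. \<exists>E' \<subseteq> E \<inter> cball x r.
                 ennreal (r ^ n / C) \<le> hausdorff_outer n E' \<and>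
                 (\<forall>V \<in> grassmann_cball n V0 \<rho>.
                    Linfty_norm_le (hausdorff_on n V) (proj_push n V E') C)))"
proof -
  \<comment> \<open>A negative \<open>M\<close> admits no Lipschitz graphs; the absolute value only makes \<open>L\<close> positive then.\<close>
  define L where "L = 2 * (1 + \<bar>M\<bar>)"
  \<comment> \<open>The entry \<open>1 / \<delta>\<close> serves the lower bound on the piece,
    \<open>L ^ n\<close> the density bound. Both \<open>L\<close> and \<open>C\<close> are fixed
    before \<open>E\<close>, so they depend only on \<open>n\<close>, \<open>M\<close> and
    \<open>\<delta>\<close>.\<close>
  define C where "C = max (1 / \<delta>) (L ^ n)"
  have L: "L > 0" by (simp add: L_def)
  have C: "C > 0" "1 / \<delta> \<le> C" "L ^ n \<le> C" using assms(3) by (auto simp: C_def less_max_iff_disj)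
  have "\<exists>V0 \<in> grassmannian n. \<exists>E' \<subseteq> E \<inter> cball x r.
      ennreal (r ^ n / C) \<le> hausdorff_outer n E' \<and>
      (\<forall>V \<in> grassmann_cball n V0 (1 / L). Linfty_norm_le (hausdorff_on n V) (proj_push n V E') C)"
    if E: "big_pieces_lipschitz_graphs n M \<delta> E" and x: "x \<in> E" and r: "r > 0" "ennreal r \<le> ediam E"
    for E :: "'a set" and x r
  proof -
    obtain \<Gamma> where \<Gamma>: "lipschitz_graph n M \<Gamma>"
        "ennreal (\<delta> * r ^ n) \<le> hausdorff_outer n (E \<inter> \<Gamma> \<inter> cball x r)"
      using E x r unfolding big_pieces_lipschitz_graphs_def by blast
    obtain P A where P: "subspace P" "dim P = n" and A: "A \<in> P \<rightarrow> P\<^sup>\<bottom>" "M-lipschitz_on P A"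
        and \<Gamma>_eq: "\<Gamma> = (\<lambda>p. p + A p) ` P"
      using \<Gamma>(1) unfolding lipschitz_graph_def by blast
    have L_eq: "L = 2 * (1 + M)" using lipschitz_on_nonneg[OF A(2)] by (simp add: L_def)
    have "r ^ n / C \<le> \<delta> * r ^ n"
    proof -
      have "1 \<le> \<delta> * C" using C(2) assms(3) by (simp add: field_simps)
      then have "1 * r ^ n \<le> (\<delta> * C) * r ^ n" using r by (intro mult_right_mono) auto
      then show ?thesis using C(1) by (simp add: field_simps)
    qed
    then have "ennreal (r ^ n / C) \<le> hausdorff_outer n (E \<inter> \<Gamma> \<inter> cball x r)"
      using \<Gamma>(2) ennreal_leI order_trans by blast
    moreover have "Linfty_norm_le (hausdorff_on n V) (proj_push n V (E \<inter> \<Gamma> \<inter> cball x r)) C"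
      if "V \<in> grassmann_cball n P (1 / L)" for V
    proof (rule Linfty_norm_le_proj_push[OF _ _ L _ C(3)])
      show V: "subspace V" "dim V = n"
        using that by (auto simp: grassmann_cball_def grassmannian_def)
      \<comment> \<open>The radius \<open>1 / L\<close> is exactly the tilt that
        \<open>orth_proj_expanding_on_graph\<close> tolerates.\<close>
      have "grassmann_dist P V \<le> 1 / (2 * (1 + M))"
        using that L_eq by (simp add: grassmann_cball_def)
      then show "dist y z \<le> L * dist (orth_proj V y) (orth_proj V z)"
        if "y \<in> E \<inter> \<Gamma> \<inter> cball x r" "z \<in> E \<inter> \<Gamma> \<inter> cball x r" for y z
        unfolding L_eq using that by (intro orth_proj_expanding_on_graph[OF P(1) A V(1)]) (auto simp: \<Gamma>_eq)
    qed
    moreover have "P \<in> grassmannian n" using P by (simp add: grassmannian_def)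
    ultimately show ?thesis
      by (intro bexI[of _ P] exI[of _ "E \<inter> \<Gamma> \<inter> cball x r"]) auto
  qed
  then show ?thesis
    using L C(1) by (intro exI[of _ "1 / L"] exI[of _ C]) auto
qed

end
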